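(* Let $\mathcal{A}=\{a_1,\dots,a_n\}\subset\mathbb{R}^d$ and let $C\in\mathbb{R}^{d\times n}$ have maximal rank $d$. Assume that the matrix $A\in\mathbb{R}^{(d+1)\times n}$ with columns $(1,a_1),\dots,(1,a_n)$ has maximal rank $d+1$, and let $B=(b_{ij})\in\mathbb{R}^{n\times k}$ and $D=(d_{ij})\in\mathbb{R}^{n\times(k+1)}$ be Gale dual matrices of $A$ and $C$ respectively. Assume that $\mathbf{0}\in\mathcal{C}^\circ$ and that $\Delta_P$ is a full dimensional bounded polytope. Assume furthermore that the following conditions hold: (1) For any $L\in\mathcal{F}(\Delta_P)$, the submatrix $\bar{B}_{\bar{L}}$ is not weakly mixed, that is, $\bar{B}_{\bar{L}}$ has a nonzero column whose entries are either all nonpositive or all nonnegative. (2) For any $i\in\bar{I}_C$ and $r$ such that $i\in K_r$, the following holds: - $\bar{b}_{rj}\cdot d_{ij}\ge 0$ for any $j=1,\dots,k$; - there exists $j\in\{1,\dots,k\}$ such that $\bar{b}_{rj}\cdot d_{ij}>0$; - for all $j\in\{1,\dots,k\}$, if $\bar{b}_{rj}=0$ then $d_{ij}=0$. Then $n_{\mathcal{A}}(C)>0$.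
   Context: Setting: $d\ge1$, $n\ge d+2$, $k=n-d-1$, and $a_1,\dots,a_n$ are distinct points of $\mathbb{R}^d$. For $C=(c_{ij})\in\mathbb{R}^{d\times n}$, $n_{\mathcal{A}}(C)$ is the (possibly infinite) number of solutions $x\in\mathbb{R}_{>0}^d$ of the system $\sum_{j=1}^n c_{ij}x^{a_j}=0$, $i=1,\dots,d$ (real exponents, $x^{a}=\prod_l x_l^{a_{l}}$). Gale dual: for $M\in\mathbb{R}^{r\times s}$ of rank $r$, a Gale dual matrix of $M$ is any $N\in\mathbb{R}^{s\times(s-r)}$ whose columns form a basis of $\ker M$. The columns of $B$ are numbered $1,\dots,k$, those of $D$ are numbered $0,\dots,k$, and $P_1,\dots,P_n\in\mathbb{R}^{k+1}$ are the rows of $D$. Cones: $\mathcal{C}^\circ=\mathbb{R}_{>0}C_1+\dots+\mathbb{R}_{>0}C_n$, where $C_1,\dots,C_n$ are the columns of $C$; $\mathcal{C}_P=\mathbb{R}_{>0}P_1+\dots+\mathbb{R}_{>0}P_n$; $\mathcal{C}_P^\nu=\{y\in\mathbb{R}^{k+1}:\langle P_i,y\rangle>0,\ i=1,\dots,n\}$; $\Delta_P=\mathcal{C}_P^\nu\cap\{y\in\mathbb{R}^{k+1}: y_0=1\}$ (coordinates $y=(y_0,\dots,y_k)$), viewed as a subset of $\mathbb{R}^k$ with coordinates $(y_1,\dots,y_k)$; full dimensional means of dimension $k$. Let $p_i(y)=\langle P_i,(1,y)\rangle$ for $y\in\mathbb{R}^k$. $\bar I_C\subset\{1,\dots,n\}$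 is the set of indices $i$ such that $P_i$ lies on the boundary of the cone $\mathcal{C}_P$. A face of $\Delta_P$ means a face of its closure. For $i\in\bar I_C$, $F_i$ is the face of $\Delta_P$ supported on $p_i(y)=0$. For a (nonempty) proper face $F$ of $\Delta_P$, $L(F)=\{i\in\bar I_C: F\subset F_i\}$, and $\mathcal{F}(\Delta_P)=\{L(F): F\text{ a proper face of }\Delta_P\}$. Indices $i_1,i_2$ are equivalent if $P_{i_1}$ and $P_{i_2}$ are proportional; $K_1,\dots,K_s$ are the equivalence classes partitioning $\bar I_C$. The matrix $\bar B=(\bar b_{rj})\in\mathbb{R}^{s\times k}$ is given by $\bar b_{rj}=\sum_{\ell\in K_r}b_{\ell j}$. For $L\subset\{1,\dots,n\}$, $\bar L=\{r\in\{1,\dots,s\}: L\cap K_r\neq\emptyset\}$, and $\bar B_{\bar L}$ is the submatrix of $\bar B$ given by the rows with index in $\bar L$. A matrix is weakly mixed if each of its columns either has only zero entries or contains both a (strictly) positive and a (strictly) negative entry. *)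

theory Defs
  imports "HOL-Analysis.Analysis"
begin

text \<open>
  The ranges \<open>1, \<dots>, d\<close>, \<open>1, \<dots>, n\<close> and \<open>1, \<dots>, k\<close> are the finite index types \<open>'d\<close>, \<open>'n\<close>, \<open>'k\<close>.
  A range \<open>0, \<dots>, m\<close> that starts at zero is an option type: \<open>None\<close> is the index \<open>0\<close>
  and \<open>Some j\<close> is the index \<open>j\<close>.
\<close>

definition prepend_one :: "real ^ 'm \<Rightarrow> real ^ ('m::finite option)" where
  "prepend_one y = (\<chi> j. case j of None \<Rightarrow> 1 | Some l \<Rightarrow> y $ l)"

definition monomial :: "real ^ 'd \<Rightarrow> real ^ 'd \<Rightarrow> real" where
  "monomial x a = (\<Prod>l\<in>UNIV. (x $ l) powr (a $ l))"

definition positive_solutions :: "('n \<Rightarrow> real ^ 'd) \<Rightarrow> real ^ 'n ^ 'd \<Rightarrow> (real ^ 'd) set" where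
  "positive_solutions a C =
     {x. (\<forall>l. 0 < x $ l) \<and> (\<forall>i. (\<Sum>j\<in>UNIV. C $ i $ j * monomial x (a j)) = 0)}"

text \<open>The number \<open>n\<^sub>\<A>(C)\<close>.\<close>

definition num_positive_solutions :: "('n \<Rightarrow> real ^ 'd) \<Rightarrow> real ^ 'n ^ 'd \<Rightarrow> enat" where
  "num_positive_solutions a C =
     (if finite (positive_solutions a C) then enat (card (positive_solutions a C)) else \<infinity>)"

definition exponent_matrix :: "('n \<Rightarrow> real ^ 'd) \<Rightarrow> real ^ 'n ^ ('d::finite option)" where
  "exponent_matrix a = (\<chi> i j. prepend_one (a j) $ i)"

text \<open>
  The injectivity of \<open>\<lambda>j. column j N\<close> is needed because \<open>columns N\<close> is a set, so it does not
  see repeated columns.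
\<close>

definition gale_dual :: "real ^ 's ^ 'r \<Rightarrow> real ^ 't ^ 's \<Rightarrow> bool" where
  "gale_dual M N \<longleftrightarrow>
     rank M = CARD('r) \<and>
     inj (\<lambda>j. column j N) \<and> independent (columns N) \<and> span (columns N) = {v. M *v v = 0}"

text \<open>The sum \<open>\<real>\<^sub>>\<^sub>0 v\<^sub>1 + \<dots> + \<real>\<^sub>>\<^sub>0 v\<^sub>n\<close>; all coefficients are strictly positive.\<close>

definition positive_cone :: "('n::finite \<Rightarrow> 'v::real_vector) \<Rightarrow> 'v set" where
  "positive_cone v = {(\<Sum>j\<in>UNIV. \<mu> j *\<^sub>R v j) | \<mu>. \<forall>j. 0 < \<mu> j}"

text \<open>In what follows \<open>D\<close> is the Gale dual of the coefficient matrix, with rows \<open>P\<^sub>i = D $ i\<close>.\<close>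

definition dual_cone :: "real ^ ('k::finite option) ^ 'n \<Rightarrow> (real ^ ('k::finite option)) set" where
  "dual_cone D = {y. \<forall>i. 0 < (D $ i) \<bullet> y}"

definition Delta :: "real ^ ('k::finite option) ^ 'n \<Rightarrow> (real ^ 'k) set" where
  "Delta D = {y. prepend_one y \<in> dual_cone D}"

definition lin_form :: "real ^ ('k::finite option) ^ 'n \<Rightarrow> 'n \<Rightarrow> real ^ 'k \<Rightarrow> real" where
  "lin_form D i y = (D $ i) \<bullet> prepend_one y"

text \<open>The set \<open>\<bar>I\<^sub>C\<close>.\<close>

definition boundary_indices :: "real ^ ('k::finite option) ^ 'n \<Rightarrow> 'n set" where
  "boundary_indices D = {i. D $ i \<in> frontier (positive_cone (\<lambda>j. D $ j))}"

text \<open>\<open>Delta D\<close> is open; its faces are by convention those of its closure.\<close>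

definition proper_faces :: "real ^ ('k::finite option) ^ 'n \<Rightarrow> (real ^ 'k) set set" where
  "proper_faces D =
     {F. F face_of closure (Delta D) \<and> F \<noteq> {} \<and> F \<noteq> closure (Delta D)}"

definition supported_face :: "real ^ ('k::finite option) ^ 'n \<Rightarrow> 'n \<Rightarrow> (real ^ 'k) set" where
  "supported_face D i = closure (Delta D) \<inter> {y. lin_form D i y = 0}"

definition face_indices :: "real ^ ('k::finite option) ^ 'n \<Rightarrow> (real ^ 'k) set \<Rightarrow> 'n set" where
  "face_indices D F = {i \<in> boundary_indices D. F \<subseteq> supported_face D i}"

text \<open>The family \<open>\<F>(\<Delta>\<^sub>P)\<close>.\<close>

definition face_index_sets :: "real ^ ('k::finite option) ^ 'n \<Rightarrow> 'n set set" where
  "face_index_sets D = face_indices D ` proper_faces D"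

definition proportional :: "'v::real_vector \<Rightarrow> 'v \<Rightarrow> bool" where
  "proportional u v \<longleftrightarrow> (\<exists>c. c \<noteq> 0 \<and> u = c *\<^sub>R v)"

text \<open>
  The set \<open>{K\<^sub>1, \<dots>, K\<^sub>s}\<close>. The classes themselves serve as row indices of \<open>\<bar>B\<close>, so no
  numbering of them is chosen.
\<close>

definition proportionality_classes :: "real ^ ('k::finite option) ^ 'n \<Rightarrow> 'n set set" where
  "proportionality_classes D =
     boundary_indices D //
       {(i, j). i \<in> boundary_indices D \<and> j \<in> boundary_indices D \<and> proportional (D $ i) (D $ j)}"

text \<open>The entry \<open>\<bar>b\<^sub>r\<^sub>j\<close> of \<open>\<bar>B\<close>, with \<open>K = K\<^sub>r\<close>.\<close>

definition bar_entry :: "real ^ 'k ^ 'n \<Rightarrow> 'n set \<Rightarrow> 'k \<Rightarrow> real" where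
  "bar_entry B K j = (\<Sum>l\<in>K. B $ l $ j)"

text \<open>The index set \<open>\<bar>L\<close>.\<close>

definition bar_index :: "real ^ ('k::finite option) ^ 'n \<Rightarrow> 'n set \<Rightarrow> 'n set set" where
  "bar_index D L = {K \<in> proportionality_classes D. L \<inter> K \<noteq> {}}"

text \<open>\<open>R\<close> and \<open>J\<close> are the sets of row and column indices of the submatrix of \<open>m\<close> concerned.\<close>

definition weakly_mixed :: "'r set \<Rightarrow> 'c set \<Rightarrow> ('r \<Rightarrow> 'c \<Rightarrow> real) \<Rightarrow> bool" where
  "weakly_mixed R J m \<longleftrightarrow>
     (\<forall>j\<in>J. (\<forall>r\<in>R. m r j = 0) \<or> ((\<exists>r\<in>R. 0 < m r j) \<and> (\<exists>r\<in>R. m r j < 0)))"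

end

theory Submission
  imports Defs
begin

text \<open>
  By Gale duality, a positive solution corresponds to a point \<open>y\<close> of \<open>\<Delta>\<^sub>P\<close> with
  \<open>\<Sum>\<^sub>i b\<^sub>i\<^sub>j ln p\<^sub>i(y) = 0\<close> for all \<open>j\<close>: these equations say that \<open>(ln p\<^sub>i(y))\<^sub>i\<close> is in the row
  space of \<open>A\<close>, so that the \<open>p\<^sub>i(y)\<close> are a common multiple of the monomials at some \<open>x\<close>. Exponentiating the
  \<open>j\<close>-th equation, with the negative and the positive \<open>\<bar>b\<^sub>r\<^sub>j\<close> on different sides, makes it
  \<open>H\<^sub>j(y) = 0\<close>, where \<open>H\<close> is continuous on the whole closure of \<open>\<Delta>\<^sub>P\<close>. On a facet
  \<open>p\<^sub>i = 0\<close> one of the two sides vanishes, and condition (2) matches the sign of \<open>H\<^sub>j\<close> with that of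
  \<open>d\<^sub>i\<^sub>j = \<partial>p\<^sub>i/\<partial>y\<^sub>j\<close>: the vector field \<open>H\<close> points weakly inwards. By Brouwer's theorem it has a
  zero in the closure. Condition (1) gives, for each boundary point, an index \<open>j\<close> for which exactly
  one side vanishes, so the zero is in \<open>\<Delta>\<^sub>P\<close> itself.
\<close>

section \<open>Zeros of inward-pointing fields and of logarithmic systems\<close>

text \<open>
  Brouwer is applied to \<open>y + H y\<close> followed by the projection onto \<open>T\<close>; at a fixed point \<open>y\<close>, the
  variational inequality of the projection, tested at \<open>y + t H y\<close>, reads \<open>t \<parallel>H y\<parallel>\<^sup>2 \<le> 0\<close>.
\<close>

lemma inward_field_zero:
  fixes H :: "'a::euclidean_space \<Rightarrow> 'a"
  assumes "compact T" "convex T" "T \<noteq> {}" "continuous_on T H"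
    and inward: "\<And>y. y \<in> T \<Longrightarrow> \<exists>t>0. y + t *\<^sub>R H y \<in> T"
  obtains y where "y \<in> T" "H y = 0"
proof -
  have "closed T" using assms(1) by (rule compact_imp_closed)
  define f where "f y = closest_point T (y + H y)" for y
  have "continuous_on T f"
    unfolding f_def
    by (rule continuous_on_compose2[OF continuous_on_closest_point[of T UNIV]])
       (use assms \<open>closed T\<close> in \<open>auto intro!: continuous_intros\<close>)
  moreover have "f \<in> T \<rightarrow> T"
    using closest_point_in_set[OF \<open>closed T\<close> assms(3)] by (auto simp: f_def)
  ultimately obtain y where y: "y \<in> T" "f y = y"
    using brouwer[OF assms(1-3)] by blast
  obtain t where t: "t > 0" "y + t *\<^sub>R H y \<in> T"
    using inward[OF y(1)] by blast
  have "(y + H y - f y) \<bullet> ((y + t *\<^sub>R H y) - f y) \<le> 0"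
    unfolding f_def by (rule closest_point_dot[OF assms(2) \<open>closed T\<close> t(2)])
  then have "t * (H y \<bullet> H y) \<le> 0" by (simp add: y(2))
  then have "H y \<bullet> H y \<le> 0" using t(1) by (metis mult_le_0_iff not_less)
  then have "H y = 0" by (metis inner_eq_zero_iff inner_ge_zero order_antisym)
  with y(1) show ?thesis by (rule that)
qed

text \<open>
  \<open>N r\<close> plays the role of the gradient of \<open>q r\<close>; only the assumption \<open>tangent\<close> relates the two.
\<close>

lemma log_system_zero:
  fixes q :: "'r \<Rightarrow> real ^ 'k::finite \<Rightarrow> real" and N :: "'r \<Rightarrow> real ^ 'k"
    and \<beta> :: "'r \<Rightarrow> 'k \<Rightarrow> real" and w :: "'k \<Rightarrow> real ^ 'k \<Rightarrow> real"
  assumes Q: "finite Q" and T: "compact T" "convex T" "T \<noteq> {}"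
    and q: "\<And>r. r \<in> Q \<Longrightarrow> continuous_on T (q r)" "\<And>r y. r \<in> Q \<Longrightarrow> y \<in> T \<Longrightarrow> 0 \<le> q r y"
    and w: "\<And>j. continuous_on T (w j)"
    and tangent: "\<And>y v. y \<in> T \<Longrightarrow> (\<And>r. r \<in> Q \<Longrightarrow> q r y = 0 \<Longrightarrow> 0 \<le> N r \<bullet> v) \<Longrightarrow>
       \<exists>t>0. y + t *\<^sub>R v \<in> T"
    and compat: "\<And>r j. r \<in> Q \<Longrightarrow> 0 \<le> \<beta> r j * N r $ j"
      "\<And>r j. r \<in> Q \<Longrightarrow> \<beta> r j = 0 \<Longrightarrow> N r $ j = 0"
    and unmixed: "\<And>y. y \<in> T \<Longrightarrow> \<exists>r\<in>Q. q r y = 0 \<Longrightarrow>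
       \<not> weakly_mixed {r\<in>Q. q r y = 0} UNIV \<beta>"
  obtains y where "y \<in> T" "\<And>r. r \<in> Q \<Longrightarrow> 0 < q r y"
    "\<And>j. (\<Sum>r\<in>Q. \<beta> r j * ln (q r y)) + w j y = 0"
proof -
  \<comment> \<open>All exponents in \<open>u\<close> and \<open>l\<close> are positive, so both
    products are continuous where some \<open>q r\<close> vanishes. Rows with \<beta> = 0 must stay
    out: \<open>0 powr 0 = 0\<close> would introduce spurious zeros.\<close>
  define u where "u j y = (\<Prod>r\<in>{r\<in>Q. \<beta> r j > 0}. q r y powr \<beta> r j)" for j y
  define l where "l j y = (\<Prod>r\<in>{r\<in>Q. \<beta> r j < 0}. q r y powr (- \<beta> r j))" for j y
  \<comment> \<open>Wherever all \<open>q r\<close> are positive, \<open>H y = 0\<close> is the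
    exponentiated system. The factor \<open>exp (- w j y)\<close> never vanishes, so it affects
    neither the signs nor the zeros of the left product.\<close>
  define H where "H y = (\<chi> j. l j y * exp (- w j y) - u j y)" for y
  have u0: "u j y = 0 \<longleftrightarrow> (\<exists>r\<in>Q. \<beta> r j > 0 \<and> q r y = 0)" for j y
    using Q by (auto simp: u_def prod_zero_iff)
  have l0: "l j y = 0 \<longleftrightarrow> (\<exists>r\<in>Q. \<beta> r j < 0 \<and> q r y = 0)" for j y
    using Q by (auto simp: l_def prod_zero_iff)
  have nn: "0 \<le> u j y" "0 \<le> l j y" for j y
    by (auto simp: u_def l_def intro!: prod_nonneg)
  have "continuous_on T (u j)" "continuous_on T (l j)" for j
    unfolding u_def l_def
    by (intro continuous_on_prod continuous_on_powr' continuous_on_const; use q in auto)+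
  then have contH: "continuous_on T H"
    unfolding H_def by (intro continuous_intros w)
  have "\<exists>t>0. y + t *\<^sub>R H y \<in> T" if y: "y \<in> T" for y
  proof (rule tangent[OF y])
    fix r assume r: "r \<in> Q" "q r y = 0"
    have "0 \<le> N r $ j * H y $ j" for j
    proof (cases "\<beta> r j" "0::real" rule: linorder_cases)
      case less
      then have "l j y = 0" using r l0 by auto
      moreover have "N r $ j \<le> 0" using compat(1)[OF r(1), of j] less by (simp add: zero_le_mult_iff)
      ultimately show ?thesis using nn by (simp add: H_def mult_nonpos_nonneg)
    next
      case equal
      then show ?thesis using compat(2)[OF r(1)] by simp
    next
      case greater
      then have "u j y = 0" using r u0 by auto
      moreover have "N r $ j \<ge> 0" using compat(1)[OF r(1), of j] greater by (simp add: zero_le_mult_iff)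
      ultimately show ?thesis using nn by (simp add: H_def)
    qed
    then show "0 \<le> N r \<bullet> H y" by (auto simp: inner_vec_def intro!: sum_nonneg)
  qed
  then obtain y where y: "y \<in> T" "H y = 0"
    using inward_field_zero[OF T contH] by blast
  then have H0: "l j y * exp (- w j y) = u j y" for j
    by (simp add: H_def vec_eq_iff)
  have pos: "0 < q r y" if r: "r \<in> Q" for r
  proof (rule ccontr)
    assume "\<not> 0 < q r y"
    then have "q r y = 0" using q(2)[OF r y(1)] by simp
    then have "\<not> weakly_mixed {r\<in>Q. q r y = 0} UNIV \<beta>" using unmixed[OF y(1)] r by blast
    then obtain j s where s: "s \<in> Q" "q s y = 0" "\<beta> s j \<noteq> 0"
      and "(\<forall>r\<in>{r\<in>Q. q r y = 0}. \<beta> r j \<le> 0) \<or> (\<forall>r\<in>{r\<in>Q. q r y = 0}. 0 \<le> \<beta> r j)"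
      unfolding weakly_mixed_def by (auto simp: not_less)
    from this(4) have "(u j y = 0) \<noteq> (l j y = 0)"
    proof
      assume neg: "\<forall>r\<in>{r\<in>Q. q r y = 0}. \<beta> r j \<le> 0"
      then have "\<beta> s j < 0" using s by fastforce
      then have "l j y = 0" unfolding l0 using s by blast
      moreover have "u j y \<noteq> 0" unfolding u0 using neg by fastforce
      ultimately show ?thesis by simp
    next
      assume nonneg: "\<forall>r\<in>{r\<in>Q. q r y = 0}. 0 \<le> \<beta> r j"
      then have "0 < \<beta> s j" using s by fastforce
      then have "u j y = 0" unfolding u0 using s by blast
      moreover have "l j y \<noteq> 0" unfolding l0 using nonneg by fastforce
      ultimately show ?thesis by simp
    qed
    then show False using H0[of j] by auto
  qed
  moreover have "(\<Sum>r\<in>Q. \<beta> r j * ln (q r y)) + w j y = 0" for j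
  proof -
    let ?P = "{r\<in>Q. \<beta> r j > 0}" and ?M = "{r\<in>Q. \<beta> r j < 0}"
    let ?s = "\<lambda>r. \<beta> r j * ln (q r y)"
    have "ln (u j y) = sum ?s ?P"
      unfolding u_def using Q by (subst ln_prod) (auto simp: ln_powr dest!: pos)
    moreover have "ln (l j y) = - sum ?s ?M"
      unfolding l_def using Q
      by (subst ln_prod) (auto simp: ln_powr simp flip: sum_negf dest!: pos)
    moreover have "0 < l j y" using nn(2)[of j y] l0[of j y] pos by fastforce
    then have "ln (u j y) = ln (l j y) - w j y"
      unfolding H0[symmetric] by (simp add: ln_mult)
    moreover have "sum ?s Q = sum ?s ?P + sum ?s ?M"
    proof -
      have "sum ?s Q = sum ?s (?P \<union> ?M)"
        by (rule sum.mono_neutral_right) (use Q in auto)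
      also have "\<dots> = sum ?s ?P + sum ?s ?M"
        by (rule sum.union_disjoint) (use Q in auto)
      finally show ?thesis .
    qed
    ultimately show ?thesis by simp
  qed
  ultimately show ?thesis using that y(1) by blast
qed

section \<open>Linear algebra of Gale duality\<close>

text \<open>The kernel is the orthogonal complement of the range of the transpose, and in finite
  dimension taking the complement twice gives that range back.\<close>

lemma orthogonal_kernel_imp_row_space:
  fixes M :: "real ^ 'n ^ 'm"
  assumes "\<And>v. M *v v = 0 \<Longrightarrow> v \<bullet> w = 0"
  obtains u where "w = transpose M *v u"
proof -
  have ad: "adjoint ((*v) M) = (*v) (transpose M)" by (rule adjoint_matrix)
  have "w \<in> orthogonal_comp {v. M *v v = 0}"
    using assms by (auto simp: orthogonal_comp_def orthogonal_def)
  also have "{v. M *v v = 0} = orthogonal_comp (range ((*v) (transpose M)))"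
    using ker_orthogonal_comp_adjoint[of "(*v) M"] by (auto simp: ad)
  also have "orthogonal_comp \<dots> = range ((*v) (transpose M))"
    by (intro orthogonal_comp_self linear_subspace_image matrix_vector_mul_linear subspace_UNIV)
  finally show ?thesis using that by blast
qed

lemma gale_dual_orthogonal:
  assumes "gale_dual M N" "\<And>j. column j N \<bullet> w = 0"
  obtains u where "w = transpose M *v u"
proof (rule orthogonal_kernel_imp_row_space[of M w])
  fix v assume "M *v v = 0"
  then have "v \<in> span (columns N)" using assms(1) by (auto simp: gale_dual_def)
  moreover have "orthogonal w x" if "x \<in> columns N" for x
    using that assms(2) by (auto simp: columns_def orthogonal_def inner_commute)
  ultimately have "orthogonal w v" by (rule orthogonal_to_span)
  then show "v \<bullet> w = 0" by (simp add: orthogonal_def inner_commute)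
qed (rule that)

lemma gale_dual_matrix_mult_zero:
  assumes "gale_dual M N"
  shows "M *v (N *v x) = 0"
proof -
  have "N *v x = (\<Sum>j\<in>UNIV. x $ j *\<^sub>R column j N)"
    by (simp add: matrix_mult_sum scalar_mult_eq_scaleR)
  also have "\<dots> \<in> span (columns N)"
    by (intro span_sum span_scale span_base) (auto simp: columns_def)
  finally show ?thesis using assms by (auto simp: gale_dual_def)
qed

section \<open>The affine forms, the closure of the polytope and its faces\<close>

lemma sum_option_UNIV:
  fixes f :: "'a::finite option \<Rightarrow> 'b::comm_monoid_add"
  shows "sum f UNIV = f None + (\<Sum>j\<in>UNIV. f (Some j))"
  by (simp add: UNIV_option_conv sum.reindex)

lemma lin_form_eq: "lin_form D i y = D $ i $ None + (\<chi> j. D $ i $ Some j) \<bullet> y"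
  by (simp add: lin_form_def prepend_one_def inner_vec_def sum_option_UNIV)

lemma lin_form_add_scaleR:
  "lin_form D i (y + t *\<^sub>R v) = lin_form D i y + t * ((\<chi> j. D $ i $ Some j) \<bullet> v)"
  by (simp add: lin_form_eq inner_add_right)

lemma lin_form_convex_comb:
  "lin_form D i ((1 - t) *\<^sub>R y + t *\<^sub>R z) = (1 - t) * lin_form D i y + t * lin_form D i z"
  by (simp add: lin_form_eq inner_add_right algebra_simps)

lemma continuous_on_lin_form [continuous_intros]: "continuous_on S (lin_form D i)"
  unfolding lin_form_eq by (intro continuous_intros)

lemma Delta_eq: "Delta D = {y. \<forall>i. 0 < lin_form D i y}"
  by (simp add: Delta_def dual_cone_def lin_form_def)

text \<open>For \<open>z\<close> in \<open>Delta D\<close>, the half-open segment from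
  \<open>z\<close> towards \<open>y\<close> stays in \<open>Delta D\<close>, because each form is
  affine, nonnegative at \<open>y\<close> and positive at \<open>z\<close>. Letting the point tend
  to \<open>y\<close> gives the nontrivial inclusion.\<close>

lemma closure_Delta:
  assumes "Delta D \<noteq> {}"
  shows "closure (Delta D) = {y. \<forall>i. 0 \<le> lin_form D i y}"
proof
  have "closed {y. \<forall>i. 0 \<le> lin_form D i y}"
    by (intro closed_Collect_all closed_Collect_le continuous_intros)
  then show "closure (Delta D) \<subseteq> {y. \<forall>i. 0 \<le> lin_form D i y}"
    by (rule closure_minimal[rotated]) (auto simp: Delta_eq less_imp_le)
next
  obtain z where z: "z \<in> Delta D" using assms by blast
  show "{y. \<forall>i. 0 \<le> lin_form D i y} \<subseteq> closure (Delta D)"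
  proof
    fix y assume y: "y \<in> {y. \<forall>i. 0 \<le> lin_form D i y}"
    have "((\<lambda>t. (1 - t) *\<^sub>R y + t *\<^sub>R z) \<longlongrightarrow> (1 - 0) *\<^sub>R y + 0 *\<^sub>R z) (at_right (0::real))"
      by (intro tendsto_intros)
    moreover have "eventually (\<lambda>t. (1 - t) *\<^sub>R y + t *\<^sub>R z \<in> closure (Delta D)) (at_right (0::real))"
      unfolding eventually_at_right_field
    proof (intro exI[of _ 1] conjI allI impI)
      fix t :: real assume "0 < t" "t < 1"
      then have "(1 - t) *\<^sub>R y + t *\<^sub>R z \<in> Delta D"
        using y z by (auto simp: Delta_eq lin_form_convex_comb add_nonneg_pos)
      then show "(1 - t) *\<^sub>R y + t *\<^sub>R z \<in> closure (Delta D)" using closure_subset by blast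
    qed simp
    ultimately have "(1 - 0) *\<^sub>R y + 0 *\<^sub>R z \<in> closure (Delta D)"
      by (intro Lim_in_closed_set) (auto simp: trivial_limit_at_right_real)
    then show "y \<in> closure (Delta D)" by simp
  qed
qed

lemma convex_closure_Delta: "convex (closure (Delta D))"
proof (rule convex_closure)
  have "convex {y. - D $ i $ None < (\<chi> j. D $ i $ Some j) \<bullet> y}" for i
    by (rule convex_halfspace_gt)
  moreover have "Delta D = (\<Inter>i. {y. - D $ i $ None < (\<chi> j. D $ i $ Some j) \<bullet> y})"
    by (auto simp: Delta_eq lin_form_eq real_0_less_add_iff)
  ultimately show "convex (Delta D)" by (simp add: convex_INT)
qed

text \<open>The vector \<open>prepend_one y\<close> is the normal of a supporting hyperplane: its
  inner product is nonnegative on the cone and zero at \<open>D $ i\<close>.\<close>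

lemma active_imp_boundary:
  assumes "\<And>i. 0 \<le> lin_form D i y" "lin_form D i y = 0"
  shows "i \<in> boundary_indices D"
proof -
  let ?v = "prepend_one y" and ?C = "positive_cone (\<lambda>j. D $ j)"
  have v: "?v \<noteq> 0" by (auto simp: vec_eq_iff prepend_one_def intro!: exI[of _ None])
  have dual: "0 \<le> x \<bullet> ?v" if "x \<in> ?C" for x
    using that assms(1)
    by (auto simp: positive_cone_def lin_form_def inner_sum_left less_imp_le intro!: sum_nonneg)
  have "D $ i \<in> closure ?C"
  proof -
    \<comment> \<open>The cone requires strictly positive coefficients, so \<open>D $ i\<close> need
      not lie in it. Adding a small multiple of the sum of all rows makes every coefficient
      positive.\<close>
    let ?f = "\<lambda>t::real. D $ i + t *\<^sub>R (\<Sum>j\<in>UNIV. D $ j)"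
    have "(?f \<longlongrightarrow> D $ i + 0 *\<^sub>R (\<Sum>j\<in>UNIV. D $ j)) (at_right 0)"
      by (intro tendsto_intros)
    moreover have "eventually (\<lambda>t. ?f t \<in> closure ?C) (at_right (0::real))"
      unfolding eventually_at_right_field
    proof (intro exI[of _ 1] conjI allI impI)
      fix t :: real assume t: "0 < t" "t < 1"
      have "?f t = (\<Sum>j\<in>UNIV. (of_bool (j = i) + t) *\<^sub>R D $ j)"
        by (simp add: scaleR_left_distrib sum.distrib scaleR_sum_right of_bool_def if_distrib[of "\<lambda>c. c *\<^sub>R _"] cong: if_cong)
      moreover have "\<forall>j. 0 < of_bool (j = i) + t" using t by simp
      ultimately have "?f t \<in> ?C"
        unfolding positive_cone_def by (intro CollectI exI[of _ "\<lambda>j. of_bool (j = i) + t"] conjI)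
      then show "?f t \<in> closure ?C" using closure_subset by blast
    qed simp
    ultimately have "D $ i + 0 *\<^sub>R (\<Sum>j\<in>UNIV. D $ j) \<in> closure ?C"
      by (intro Lim_in_closed_set) (auto simp: trivial_limit_at_right_real)
    then show ?thesis by simp
  qed
  moreover have "D $ i \<notin> interior ?C"
  proof
    assume "D $ i \<in> interior ?C"
    then obtain e where e: "e > 0" "cball (D $ i) e \<subseteq> ?C" by (auto simp: mem_interior_cball)
    \<comment> \<open>A step of length \<open>e\<close> against the normal stays in the ball but
      makes the inner product negative.\<close>
    have "D $ i - (e / norm ?v) *\<^sub>R ?v \<in> ?C" using e v by (auto simp: dist_norm)
    then have "0 \<le> (D $ i - (e / norm ?v) *\<^sub>R ?v) \<bullet> ?v" by (rule dual)
    then have "(e / norm ?v) * (?v \<bullet> ?v) \<le> 0"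
      using assms(2) by (simp add: inner_diff_left lin_form_def)
    moreover have "(e / norm ?v) * (?v \<bullet> ?v) > 0" using e v by simp
    ultimately show False by simp
  qed
  ultimately show ?thesis by (simp add: boundary_indices_def frontier_def)
qed

text \<open>This makes condition (1), which is about faces, available at a single point
  \<open>y\<close>. The face is the intersection of all supported faces through \<open>y\<close>;
  since it contains \<open>y\<close>, no form that is positive at \<open>y\<close> can vanish on all
  of it.\<close>

lemma active_indices_mem_face_index_sets:
  assumes ne: "Delta D \<noteq> {}" and y: "y \<in> closure (Delta D)" and i: "lin_form D i y = 0"
  shows "{i. lin_form D i y = 0} \<in> face_index_sets D"
proof -
  let ?T = "closure (Delta D)" and ?L = "{i. lin_form D i y = 0}"
  define F where "F = \<Inter> (supported_face D ` ?L)"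
  have T: "?T = {y. \<forall>i. 0 \<le> lin_form D i y}" by (rule closure_Delta[OF ne])
  have "supported_face D j face_of ?T" for j
  proof -
    have "?T \<inter> {y. (\<chi> l. D $ j $ Some l) \<bullet> y = - D $ j $ None} face_of ?T"
      by (rule face_of_Int_supporting_hyperplane_ge[OF convex_closure_Delta])
         (auto simp: T lin_form_eq dest!: spec[of _ j])
    moreover have "{y. (\<chi> l. D $ j $ Some l) \<bullet> y = - D $ j $ None} = {y. lin_form D j y = 0}"
      by (auto simp: lin_form_eq)
    ultimately show ?thesis by (simp add: supported_face_def)
  qed
  then have "F face_of ?T" unfolding F_def using i by (intro face_of_Inter) auto
  moreover have yF: "y \<in> F" using y by (auto simp: F_def supported_face_def)
  moreover have "F \<noteq> ?T"
  proof
    assume F: "F = ?T"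
    obtain z where z: "z \<in> Delta D" using ne by blast
    then have "z \<in> F" using F closure_subset by blast
    moreover have "F \<subseteq> supported_face D i" using i by (auto simp: F_def)
    ultimately have "lin_form D i z = 0" by (auto simp: supported_face_def)
    then show False using z by (auto simp: Delta_eq dest!: spec[of _ i])
  qed
  ultimately have "F \<in> proper_faces D" by (auto simp: proper_faces_def)
  moreover have "face_indices D F = ?L"
  proof -
    have "j \<in> boundary_indices D" if "lin_form D j y = 0" for j
      using active_imp_boundary[of D y j] that y T by auto
    moreover have "F \<subseteq> supported_face D j" if "lin_form D j y = 0" for j
      using that by (auto simp: F_def)
    moreover have "lin_form D j y = 0" if "F \<subseteq> supported_face D j" for j
      using that yF by (auto simp: supported_face_def)
    ultimately show ?thesis unfolding face_indices_def by blast
  qed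
  ultimately show ?thesis unfolding face_index_sets_def by (metis imageI)
qed

section \<open>Grouping the forms by proportionality and solving the logarithmic system\<close>

lemma equiv_proportional: "equiv S {(i, j). i \<in> S \<and> j \<in> S \<and> proportional (v i) (v j)}"
proof (rule equivI)
  show "refl_on S {(i, j). i \<in> S \<and> j \<in> S \<and> proportional (v i) (v j)}"
    by (auto simp: refl_on_def proportional_def intro!: exI[of _ 1])
  show "sym {(i, j). i \<in> S \<and> j \<in> S \<and> proportional (v i) (v j)}"
  proof (rule symI)
    fix i j assume a: "(i, j) \<in> {(i, j). i \<in> S \<and> j \<in> S \<and> proportional (v i) (v j)}"
    then obtain c where "c \<noteq> 0" "v i = c *\<^sub>R v j" by (auto simp: proportional_def)
    then have "v j = inverse c *\<^sub>R v i" "inverse c \<noteq> 0" by auto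
    then show "(j, i) \<in> {(i, j). i \<in> S \<and> j \<in> S \<and> proportional (v i) (v j)}"
      using a unfolding proportional_def by blast
  qed
  show "trans {(i, j). i \<in> S \<and> j \<in> S \<and> proportional (v i) (v j)}"
    by (rule transI) (auto simp: proportional_def, metis mult_eq_0_iff)
qed auto

text \<open>An instance of \<open>log_system_zero\<close> with one function \<open>q K\<close> for
  each proportionality class. Forms outside \<open>boundary_indices D\<close> have no zero on the
  closure, so their logarithms go into the continuous term \<open>w\<close>.\<close>

lemma Delta_log_system_zero:
  fixes B :: "real ^ 'k::finite ^ 'n::finite" and D :: "real ^ ('k option) ^ 'n"
  assumes ne: "Delta D \<noteq> {}" and bdd: "bounded (Delta D)"
    and unmixed: "\<And>L. L \<in> face_index_sets D \<Longrightarrow> \<not> weakly_mixed (bar_index D L) UNIV (bar_entry B)"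
    and compat: "\<And>i K j. i \<in> boundary_indices D \<Longrightarrow> K \<in> proportionality_classes D \<Longrightarrow> i \<in> K \<Longrightarrow>
           0 \<le> bar_entry B K j * D $ i $ Some j"
      "\<And>i K j. i \<in> boundary_indices D \<Longrightarrow> K \<in> proportionality_classes D \<Longrightarrow> i \<in> K \<Longrightarrow>
           bar_entry B K j = 0 \<Longrightarrow> D $ i $ Some j = 0"
  obtains y where "y \<in> Delta D" "\<And>j. (\<Sum>i\<in>UNIV. B $ i $ j * ln (lin_form D i y)) = 0"
proof -
  let ?T = "closure (Delta D)" and ?p = "lin_form D" and ?Q = "proportionality_classes D"
    and ?I = "boundary_indices D"
  have T: "?T = {y. \<forall>i. 0 \<le> ?p i y}" by (rule closure_Delta[OF ne])
  obtain z where z: "z \<in> Delta D" using ne by blast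
  then have pz: "0 < ?p i z" for i by (auto simp: Delta_eq)
  let ?rel = "{(i, j). i \<in> ?I \<and> j \<in> ?I \<and> proportional (D $ i) (D $ j)}"
  have eqv: "equiv ?I ?rel" by (rule equiv_proportional)
  define e where "e K = (SOME i. i \<in> K)" for K :: "'n set"
  have eK: "e K \<in> K" if "K \<in> ?Q" for K
    using in_quotient_imp_non_empty[OF eqv] that
    by (auto simp: e_def proportionality_classes_def some_in_eq)
  have QI: "K \<subseteq> ?I" if "K \<in> ?Q" for K
    using in_quotient_imp_subset[OF eqv] that by (auto simp: proportionality_classes_def)
  \<comment> \<open>Normalized at \<open>z\<close>, a form depends only on its proportionality class.\<close>
  define q where "q K y = ?p (e K) y / ?p (e K) z" for K y
  have pq: "?p i y = ?p i z * q K y" if K: "K \<in> ?Q" "i \<in> K" for i K y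
  proof -
    have "(i, e K) \<in> ?rel"
      using quotient_eq_iff[OF eqv, of K K i "e K"] K eK[OF K(1)] by (simp add: proportionality_classes_def)
    then obtain c where c: "D $ i = c *\<^sub>R D $ e K" by (auto simp: proportional_def)
    then have "?p i x = c * ?p (e K) x" for x by (simp add: lin_form_def)
    then show ?thesis using pz[of "e K"] by (simp add: q_def)
  qed
  have p0: "?p i y = 0 \<longleftrightarrow> q K y = 0" if K: "K \<in> ?Q" "i \<in> K" for i K y
    using pz[of i] unfolding pq[OF K, of y] by auto
  have IQ: "\<exists>K\<in>?Q. i \<in> K" if "i \<in> ?I" for i
    using Union_quotient[OF eqv] that by (auto simp: proportionality_classes_def)
  \<comment> \<open>The second sum is constant in \<open>y\<close>; it makes up for dividing the
    boundary forms by their values at \<open>z\<close>.\<close>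
  define w where "w j y = (\<Sum>i\<in>-?I. B $ i $ j * ln (?p i y)) + (\<Sum>i\<in>?I. B $ i $ j * ln (?p i z))" for j y
  have wcont: "continuous_on ?T (w j)" for j
    unfolding w_def
    by (intro continuous_intros) (use active_imp_boundary[of D] T in auto)
  define N where "N K = (\<chi> j. D $ e K $ Some j)" for K
  \<comment> \<open>Each of the finitely many forms stays nonnegative along \<open>v\<close> for all
    small t > 0: an inactive one by continuity, an active one because its slope is nonnegative.
    Hence a common t exists.\<close>
  have tangent: "\<exists>t>0. y + t *\<^sub>R v \<in> ?T"
    if y: "y \<in> ?T" and v: "\<And>K. K \<in> ?Q \<Longrightarrow> q K y = 0 \<Longrightarrow> 0 \<le> N K \<bullet> v" for y v
  proof -
    let ?d = "\<lambda>i. (\<chi> j. D $ i $ Some j) \<bullet> v"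
    have "eventually (\<lambda>t. 0 \<le> ?p i (y + t *\<^sub>R v)) (at_right (0::real))" for i
    proof (cases "?p i y = 0")
      case True
      then have iI: "i \<in> ?I" using active_imp_boundary[of D y i] y T by auto
      then obtain K where K: "K \<in> ?Q" "i \<in> K" using IQ by blast
      have "0 \<le> N K \<bullet> v" using v[OF K(1)] p0[OF K, of y] True by blast
      \<comment> \<open>The assumption on \<open>v\<close> concerns only the representative
        \<open>e K\<close>. As the forms of \<open>K\<close> are affine and vanish at
        \<open>y\<close>, their values at \<open>y + v\<close> are their slopes along
        \<open>v\<close>, and \<open>pq\<close> carries the sign over to \<open>i\<close>.\<close>
      then have eK0: "0 \<le> ?p (e K) (y + 1 *\<^sub>R v)"
        using p0[OF K(1) eK[OF K(1)], of y] p0[OF K, of y] True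
        unfolding lin_form_add_scaleR N_def by simp
      then have "0 \<le> q K (y + 1 *\<^sub>R v)" unfolding q_def using pz[of "e K"] by (simp add: divide_nonneg_pos)
      then have "0 \<le> ?p i (y + 1 *\<^sub>R v)"
        unfolding pq[OF K, of "y + 1 *\<^sub>R v"] by (rule mult_nonneg_nonneg[OF less_imp_le[OF pz]])
      then have "0 \<le> ?d i" using True unfolding lin_form_add_scaleR by simp
      then show ?thesis
        using True unfolding lin_form_add_scaleR
        by (auto simp: eventually_at_right_field intro!: exI[of _ 1])
    next
      case False
      then have "0 < ?p i y" using y T by (auto simp: less_le)
      moreover have "((\<lambda>t. ?p i (y + t *\<^sub>R v)) \<longlongrightarrow> ?p i y + 0 * ?d i) (at_right 0)"
        unfolding lin_form_add_scaleR by (intro tendsto_intros)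
      ultimately have "eventually (\<lambda>t. 0 < ?p i (y + t *\<^sub>R v)) (at_right (0::real))"
        by (intro order_tendstoD(1)) auto
      then show ?thesis by eventually_elim simp
    qed
    then have "eventually (\<lambda>t. 0 < t \<and> (\<forall>i. 0 \<le> ?p i (y + t *\<^sub>R v))) (at_right (0::real))"
      by (intro eventually_conj eventually_at_right_less eventually_all_finite)
    then obtain t where "0 < t" "\<forall>i. 0 \<le> ?p i (y + t *\<^sub>R v)"
      using eventually_happens[OF _ ] trivial_limit_at_right_real by blast
    then show ?thesis unfolding T by blast
  qed
  have mixed: "\<not> weakly_mixed {K\<in>?Q. q K y = 0} UNIV (bar_entry B)"
    if y: "y \<in> ?T" and K: "\<exists>K\<in>?Q. q K y = 0" for y
  proof -
    let ?L = "{i. ?p i y = 0}"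
    obtain K where K: "K \<in> ?Q" "q K y = 0" using K by blast
    then have "?p (e K) y = 0" using p0[OF K(1) eK[OF K(1)]] by simp
    then have "?L \<in> face_index_sets D" by (rule active_indices_mem_face_index_sets[OF ne y])
    \<comment> \<open>The forms of a class vanish simultaneously, so a class meets \<open>?L\<close>
      exactly when its \<open>q K\<close> is zero at \<open>y\<close>.\<close>
    moreover have "bar_index D ?L = {K\<in>?Q. q K y = 0}"
      unfolding bar_index_def using p0 eK by blast
    ultimately show ?thesis using unmixed by metis
  qed
  obtain y where y: "y \<in> ?T" "\<And>K. K \<in> ?Q \<Longrightarrow> 0 < q K y"
    and sys: "\<And>j. (\<Sum>K\<in>?Q. bar_entry B K j * ln (q K y)) + w j y = 0"
  proof (rule log_system_zero[of ?Q ?T q w N "bar_entry B"])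
    show "compact ?T" using bdd by (simp add: compact_closure)
    show "continuous_on ?T (q K)" for K
      unfolding q_def using pz[of "e K"] by (intro continuous_intros) auto
    show "0 \<le> q K y" if "y \<in> ?T" for K y
      unfolding q_def using pz[of "e K"] that T by (auto intro!: divide_nonneg_pos)
    show "0 \<le> bar_entry B K j * N K $ j" if "K \<in> ?Q" for K j
      using compat(1)[of "e K" K j] that eK QI by (auto simp: N_def)
    show "N K $ j = 0" if "K \<in> ?Q" "bar_entry B K j = 0" for K j
      using compat(2)[of "e K" K j] that eK QI by (auto simp: N_def)
    show "?T \<noteq> {}" using z closure_subset by blast
    show "\<exists>t>0. y + t *\<^sub>R v \<in> ?T"
      if "y \<in> ?T" "\<And>K. K \<in> ?Q \<Longrightarrow> q K y = 0 \<Longrightarrow> 0 \<le> N K \<bullet> v" for y v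
      by (rule tangent[OF that])
    show "\<not> weakly_mixed {K\<in>?Q. q K y = 0} UNIV (bar_entry B)"
      if "y \<in> ?T" "\<exists>K\<in>?Q. q K y = 0" for y
      by (rule mixed[OF that])
  qed (simp_all only: finite convex_closure_Delta wcont that)
  have "0 < ?p i y" for i
  proof (rule ccontr)
    assume "\<not> 0 < ?p i y"
    then have i0: "?p i y = 0" using y(1) T by (metis (mono_tags) less_le mem_Collect_eq)
    then have "i \<in> ?I" using active_imp_boundary[of D y i] y(1) T by auto
    then obtain K where "K \<in> ?Q" "i \<in> K" using IQ by blast
    then show False using p0 i0 y(2)[of K] by auto
  qed
  then have "y \<in> Delta D" by (simp add: Delta_eq)
  moreover have "(\<Sum>i\<in>UNIV. B $ i $ j * ln (?p i y)) = 0" for j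
  proof -
    have disj: "\<forall>K\<in>?Q. \<forall>K'\<in>?Q. K \<noteq> K' \<longrightarrow> K \<inter> K' = {}"
      using quotient_disj[OF eqv] unfolding proportionality_classes_def by blast
    have U: "\<Union>?Q = ?I" unfolding proportionality_classes_def by (rule Union_quotient[OF eqv])
    let ?g = "\<lambda>i. B $ i $ j * (ln (?p i y) - ln (?p i z))"
    \<comment> \<open>Within a class the difference of logarithms is the same number
      \<open>ln (q K y)\<close>, so the coefficients add up to
      \<open>bar_entry B K j\<close>.\<close>
    have "sum ?g ?I = (\<Sum>K\<in>?Q. sum ?g K)"
      using sum.Union_disjoint[of ?Q ?g] disj U by simp
    also have "\<dots> = (\<Sum>K\<in>?Q. bar_entry B K j * ln (q K y))"
    proof (rule sum.cong[OF refl])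
      fix K assume K: "K \<in> ?Q"
      have "ln (?p i y) - ln (?p i z) = ln (q K y)" if "i \<in> K" for i
        unfolding pq[OF K that, of y] using pz[of i] y(2)[OF K] by (simp add: ln_mult)
      then show "sum ?g K = bar_entry B K j * ln (q K y)"
        by (simp add: bar_entry_def sum_distrib_right)
    qed
    finally have "sum ?g ?I + w j y = 0" using sys[of j] by simp
    moreover have "(\<Sum>i\<in>UNIV. B $ i $ j * ln (?p i y)) =
        (\<Sum>i\<in>?I. B $ i $ j * ln (?p i y)) + (\<Sum>i\<in>-?I. B $ i $ j * ln (?p i y))"
      using sum.union_disjoint[of ?I "-?I" "\<lambda>i. B $ i $ j * ln (?p i y)"] by (simp add: Compl_partition)
    ultimately show ?thesis
      by (simp add: w_def right_diff_distrib sum_subtractf)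
  qed
  ultimately show ?thesis using that by blast
qed

section \<open>From a zero in the polytope to a positive solution\<close>

theorem theorem3p8:
  fixes a :: "'n::finite \<Rightarrow> real ^ 'd::finite"
    and C :: "real ^ 'n ^ 'd"
    and B :: "real ^ 'k::finite ^ 'n"
    and D :: "real ^ ('k option) ^ 'n"
  assumes "CARD('n) \<ge> CARD('d) + 2"
    and "CARD('k) = CARD('n) - CARD('d) - 1"
    and "inj a"
    and "rank C = CARD('d)"
    and "rank (exponent_matrix a) = CARD('d) + 1"
    and "gale_dual (exponent_matrix a) B"
    and "gale_dual C D"
    and "0 \<in> positive_cone (\<lambda>j. column j C)"
    and "aff_dim (Delta D) = int CARD('k)"
    and "bounded (Delta D)"
    and "\<And>L. L \<in> face_index_sets D \<Longrightarrow> \<not> weakly_mixed (bar_index D L) UNIV (bar_entry B)"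
    and "\<And>i K. i \<in> boundary_indices D \<Longrightarrow> K \<in> proportionality_classes D \<Longrightarrow> i \<in> K \<Longrightarrow>
           (\<forall>j. bar_entry B K j * D $ i $ Some j \<ge> 0) \<and>
           (\<exists>j. bar_entry B K j * D $ i $ Some j > 0) \<and>
           (\<forall>j. bar_entry B K j = 0 \<longrightarrow> D $ i $ Some j = 0)"
  shows "num_positive_solutions a C > 0"
proof -
  let ?p = "lin_form D"
  \<comment> \<open>The empty set has \<open>aff_dim\<close> equal to -1.\<close>
  have "Delta D \<noteq> {}" using assms(9) by auto
  then obtain y where y: "y \<in> Delta D"
    and sys: "\<And>j. (\<Sum>i\<in>UNIV. B $ i $ j * ln (?p i y)) = 0"
    by (rule Delta_log_system_zero[OF _ assms(10,11)]) (use assms(12) in blast)+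
  have pos: "0 < ?p i y" for i using y by (simp add: Delta_eq)
  have "column j B \<bullet> (\<chi> i. ln (?p i y)) = 0" for j
    using sys[of j] by (simp add: inner_vec_def column_def)
  then obtain u where u: "(\<chi> i. ln (?p i y)) = transpose (exponent_matrix a) *v u"
    by (rule gale_dual_orthogonal[OF assms(6)])
  \<comment> \<open>The coordinate \<open>u $ None\<close> multiplies the row of ones of the
    exponent matrix and yields the common factor; the others are the logarithms of the coordinates
    of the solution.\<close>
  define x :: "real ^ 'd" where "x = (\<chi> l. exp (u $ Some l))"
  have mono: "?p i y = exp (u $ None) * monomial x (a i)" for i
  proof -
    have "ln (?p i y) = u $ None + (\<Sum>l\<in>UNIV. a i $ l * u $ Some l)"
      using arg_cong[OF u, of "\<lambda>v. v $ i"]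
      by (simp add: matrix_vector_mult_def transpose_def exponent_matrix_def prepend_one_def
          sum_option_UNIV)
    then have "?p i y = exp (u $ None + (\<Sum>l\<in>UNIV. a i $ l * u $ Some l))"
      using pos[of i] by (metis exp_ln)
    then show ?thesis by (simp add: exp_add exp_sum monomial_def x_def powr_def)
  qed
  \<comment> \<open>The values of the forms at \<open>y\<close> form a vector in the kernel of
    \<open>C\<close>; dividing by the positive common factor leaves the monomials at
    \<open>x\<close>.\<close>
  have "C *v (D *v prepend_one y) = 0" by (rule gale_dual_matrix_mult_zero[OF assms(7)])
  moreover have "D *v prepend_one y = (\<chi> i. ?p i y)"
    by (simp add: vec_eq_iff lin_form_def matrix_vector_mul_component)
  ultimately have "(\<Sum>j\<in>UNIV. C $ i $ j * ?p j y) = 0" for i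
    by (simp add: vec_eq_iff matrix_vector_mult_def)
  then have "exp (u $ None) * (\<Sum>j\<in>UNIV. C $ i $ j * monomial x (a j)) = 0" for i
    by (simp add: mono sum_distrib_left mult_ac)
  then have "x \<in> positive_solutions a C" by (simp add: positive_solutions_def x_def)
  then show ?thesis
    unfolding num_positive_solutions_def by (auto simp: card_gt_0_iff zero_enat_def)
qed

end
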